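(* Let $t\in\mathbb{R}\setminus\{0\}$ and $\mathbf{n}=(n_1,n_2,n_3)\in\mathbb{N}_0^3$. Then the function $\eta^{\mathbf{n}}:\mathbb{H}_t\to\mathbb{H}_t$ defined in the context is a $t$-harmonic $t$-regular function on $\mathbb{H}_t$, i.e. $$\eta^{\mathbf{n}}\nabla_t=\nabla_t\eta^{\mathbf{n}}=0\quad\text{and}\quad\varDelta_t\eta^{\mathbf{n}}=0\quad\text{on }\mathbb{H}_t.$$
   Context: For $t\in\mathbb{R}$, $\mathbb{H}_t$ (the $t$-scaled hypercomplexes) is the associative unital real algebra with $\mathbb{R}$-basis $\{1,i,j_t,k_t\}$ and multiplication determined by $i^2=-1$, $j_t^2=k_t^2=t$, $ij_t=k_t$, $j_tk_t=-ti$, $k_ti=j_t$, $j_ti=-k_t$, $ik_t=-j_t$, $k_tj_t=ti$. Its elements are written $w=x_1+x_2i+x_3j_t+x_4k_t$ with $x_1,\dots,x_4\in\mathbb{R}$, and $\mathbb{H}_t$ is identified with $\mathbb{R}^4$ for differentiation. $\mathbb{N}_0=\{0,1,2,\dots\}$. For $t\neq0$, $\mathrm{sgn}(t)=1$ if $t>0$ and $-1$ if $t<0$. For a differentiable $f$, $$\nabla_t f=\frac{\partial f}{\partial x_1}+i\frac{\partial f}{\partial x_2}-\frac{\mathrm{sgn}(t)}{\sqrt{|t|}}j_t\frac{\partial f}{\partial x_3}-\frac{\mathrm{sgn}(t)}{\sqrt{|t|}}k_t\frac{\partial f}{\partial x_4},\qquad f\nabla_t=\frac{\partial f}{\partial x_1}+\frac{\partial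 f}{\partial x_2}i-\frac{\mathrm{sgn}(t)}{\sqrt{|t|}}\frac{\partial f}{\partial x_3}j_t-\frac{\mathrm{sgn}(t)}{\sqrt{|t|}}\frac{\partial f}{\partial x_4}k_t;$$ $f$ is $t$-regular if $\nabla_tf=0$ and $f\nabla_t=0$. With $\varDelta_t=\frac{\partial^2}{\partial x_1^2}+\frac{\partial^2}{\partial x_2^2}-\mathrm{sgn}(t)\frac{\partial^2}{\partial x_3^2}-\mathrm{sgn}(t)\frac{\partial^2}{\partial x_4^2}$, $f$ is $t$-harmonic if $\varDelta_tf=0$. The symmetrized product of functions $f_1,\dots,f_N:\mathbb{H}_t\to\mathbb{H}_t$ is $f_1\times\cdots\times f_N=\frac{1}{N!}\sum_{\sigma\in S_N}f_{\sigma(1)}f_{\sigma(2)}\cdots f_{\sigma(N)}$ (pointwise products in $\mathbb{H}_t$). In such a product, $f^{(n)}$ stands for $n$ repeated factors $f\times\cdots\times f$ ($n$ times), and $f^{(0)}=1$. Thus $\eta_2^{(n_1)}\times\eta_3^{(n_2)}\times\eta_4^{(n_3)}$ is the symmetrized product of the list of $n_1+n_2+n_3$ functions consisting of $n_1$ copies of $\eta_2$, $n_2$ copies of $\eta_3$ and $n_3$ copies of $\eta_4$ (equal to the constant $1$ if the list is empty). Here $$\eta_2(w)=x_2-x_1i,\quad \eta_3(w)=x_3+\frac{\mathrm{sgn}(t)x_1}{\sqrt{|t|}}j_t,\quad \eta_4(w)=x_4+\frac{\mathrm{sgn}(t)x_1}{\sqrt{|t|}}k_t,$$ and $$\eta^{\mathbf{n}}=\frac{1}{n_1!\,n_2!\,n_3!}\left(\eta_2^{(n_1)}\times\eta_3^{(n_2)}\times\eta_4^{(n_3)}\right).$$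 *)

theory Defs
  imports "HOL-Analysis.Analysis" "HOL-Combinatorics.Permutations"
begin

text \<open>The algebra of \<open>t\<close>-scaled hypercomplexes is carried by \<open>real^4\<close>, independently of
  \<open>t\<close>: the vector \<open>(x1, x2, x3, x4)\<close> stands for \<open>x1 + x2 i + x3 j + x4 k\<close>. Only the
  multiplication depends on \<open>t\<close>, hence it is an explicit operation and not a class instance.\<close>

type_synonym hyp = "real^4"

definition h1 :: hyp where "h1 = axis 1 1"
definition hi :: hyp where "hi = axis 2 1"
definition hj :: hyp where "hj = axis 3 1"
definition hk :: hyp where "hk = axis 4 1"

definition hmult :: "real \<Rightarrow> hyp \<Rightarrow> hyp \<Rightarrow> hyp" where
  "hmult t x y =
     (x$1 * y$1 - x$2 * y$2 + t * (x$3 * y$3) + t * (x$4 * y$4)) *\<^sub>R h1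
     + (x$1 * y$2 + x$2 * y$1 - t * (x$3 * y$4) + t * (x$4 * y$3)) *\<^sub>R hi
     + (x$1 * y$3 + x$3 * y$1 - x$2 * y$4 + x$4 * y$2) *\<^sub>R hj
     + (x$1 * y$4 + x$4 * y$1 + x$2 * y$3 - x$3 * y$2) *\<^sub>R hk"

text \<open>The following facts characterise \<open>hmult t\<close> as the unital associative real algebra
  multiplication given by the table of the basis \<open>1, i, j, k\<close>.\<close>

lemma hyp_basis_nth [simp]:
  "h1$1 = 1" "h1$2 = 0" "h1$3 = 0" "h1$4 = 0"
  "hi$1 = 0" "hi$2 = 1" "hi$3 = 0" "hi$4 = 0"
  "hj$1 = 0" "hj$2 = 0" "hj$3 = 1" "hj$4 = 0"
  "hk$1 = 0" "hk$2 = 0" "hk$3 = 0" "hk$4 = 1"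
  by (simp_all add: h1_def hi_def hj_def hk_def axis_def)

lemma hyp_eq_iff: "(x :: hyp) = y \<longleftrightarrow> x$1 = y$1 \<and> x$2 = y$2 \<and> x$3 = y$3 \<and> x$4 = y$4"
  by (simp add: vec_eq_iff forall_4)

lemma hyp_basis_expansion: "w = w$1 *\<^sub>R h1 + w$2 *\<^sub>R hi + w$3 *\<^sub>R hj + w$4 *\<^sub>R hk"
  by (simp add: hyp_eq_iff)

lemma bilinear_hmult: "bilinear (hmult t)"
  unfolding bilinear_def linear_iff by (simp add: hyp_eq_iff hmult_def algebra_simps)

lemma hmult_assoc: "hmult t (hmult t x y) z = hmult t x (hmult t y z)"
  by (simp add: hyp_eq_iff hmult_def algebra_simps)

lemma hmult_one [simp]: "hmult t h1 x = x" "hmult t x h1 = x"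
  by (simp_all add: hyp_eq_iff hmult_def)

lemma hmult_table:
  "hmult t hi hi = - h1" "hmult t hj hj = t *\<^sub>R h1" "hmult t hk hk = t *\<^sub>R h1"
  "hmult t hi hj = hk" "hmult t hj hk = - (t *\<^sub>R hi)" "hmult t hk hi = hj"
  "hmult t hj hi = - hk" "hmult t hi hk = - hj" "hmult t hk hj = t *\<^sub>R hi"
  by (simp_all add: hyp_eq_iff hmult_def)

definition partial_deriv :: "4 \<Rightarrow> (hyp \<Rightarrow> hyp) \<Rightarrow> hyp \<Rightarrow> hyp" where
  "partial_deriv m f w = vector_derivative (\<lambda>s. f (w + s *\<^sub>R axis m 1)) (at 0)"

definition nabla_left :: "real \<Rightarrow> (hyp \<Rightarrow> hyp) \<Rightarrow> hyp \<Rightarrow> hyp" where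
  "nabla_left t f w =
     partial_deriv 1 f w + hmult t hi (partial_deriv 2 f w)
     - (sgn t / sqrt \<bar>t\<bar>) *\<^sub>R hmult t hj (partial_deriv 3 f w)
     - (sgn t / sqrt \<bar>t\<bar>) *\<^sub>R hmult t hk (partial_deriv 4 f w)"

definition nabla_right :: "real \<Rightarrow> (hyp \<Rightarrow> hyp) \<Rightarrow> hyp \<Rightarrow> hyp" where
  "nabla_right t f w =
     partial_deriv 1 f w + hmult t (partial_deriv 2 f w) hi
     - (sgn t / sqrt \<bar>t\<bar>) *\<^sub>R hmult t (partial_deriv 3 f w) hj
     - (sgn t / sqrt \<bar>t\<bar>) *\<^sub>R hmult t (partial_deriv 4 f w) hk"

definition laplace :: "real \<Rightarrow> (hyp \<Rightarrow> hyp) \<Rightarrow> hyp \<Rightarrow> hyp" where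
  "laplace t f w =
     partial_deriv 1 (partial_deriv 1 f) w + partial_deriv 2 (partial_deriv 2 f) w
     - sgn t *\<^sub>R partial_deriv 3 (partial_deriv 3 f) w
     - sgn t *\<^sub>R partial_deriv 4 (partial_deriv 4 f) w"

text \<open>\<open>vector_derivative\<close> is total, so differentiability is demanded explicitly below: the
  equations then speak about genuine derivatives.\<close>

definition t_regular :: "real \<Rightarrow> (hyp \<Rightarrow> hyp) \<Rightarrow> bool" where
  "t_regular t f \<longleftrightarrow>
     (\<forall>w. f differentiable (at w)) \<and>
     (\<forall>w. nabla_left t f w = 0) \<and> (\<forall>w. nabla_right t f w = 0)"

definition t_harmonic :: "real \<Rightarrow> (hyp \<Rightarrow> hyp) \<Rightarrow> bool" where
  "t_harmonic t f \<longleftrightarrow>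
     (\<forall>w. f differentiable (at w)) \<and>
     (\<forall>m w. partial_deriv m f differentiable (at w)) \<and>
     (\<forall>w. laplace t f w = 0)"

definition hprod_list :: "real \<Rightarrow> hyp list \<Rightarrow> hyp" where
  "hprod_list t xs = foldr (hmult t) xs h1"

text \<open>Permutations act on the positions of the list, so repeated factors are counted with
  multiplicity, and the product of the empty list is the constant \<open>h1\<close>.\<close>

definition sym_prod :: "real \<Rightarrow> (hyp \<Rightarrow> hyp) list \<Rightarrow> hyp \<Rightarrow> hyp" where
  "sym_prod t fs w =
     (1 / fact (length fs)) *\<^sub>R
       (\<Sum>\<sigma> | \<sigma> permutes {..<length fs}.
          hprod_list t (map (\<lambda>m. (fs ! \<sigma> m) w) [0..<length fs]))"

definition eta2 :: "hyp \<Rightarrow> hyp" where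
  "eta2 w = w$2 *\<^sub>R h1 - w$1 *\<^sub>R hi"

definition eta3 :: "real \<Rightarrow> hyp \<Rightarrow> hyp" where
  "eta3 t w = w$3 *\<^sub>R h1 + (sgn t * w$1 / sqrt \<bar>t\<bar>) *\<^sub>R hj"

definition eta4 :: "real \<Rightarrow> hyp \<Rightarrow> hyp" where
  "eta4 t w = w$4 *\<^sub>R h1 + (sgn t * w$1 / sqrt \<bar>t\<bar>) *\<^sub>R hk"

definition eta :: "real \<Rightarrow> nat \<times> nat \<times> nat \<Rightarrow> hyp \<Rightarrow> hyp" where
  "eta t = (\<lambda>(n1, n2, n3) w.
     (1 / (fact n1 * fact n2 * fact n3)) *\<^sub>R
       sym_prod t (replicate n1 eta2 @ replicate n2 (eta3 t) @ replicate n3 (eta4 t)) w)"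

end

theory Submission
  imports Defs "HOL-Combinatorics.Multiset_Permutations"
begin

text \<open>Let \<open>T A\<close> be the sum, over all orderings of a finite set \<open>A\<close> of factors, of the ordered
  products, so that \<open>T A = (\<Sum>a\<in>A. f a \<cdot> T (A - {a}))\<close>. Each factor is
  \<open>f a w = w\<^sub>m + w\<^sub>1 e\<^sub>m\<close> for some \<open>m\<close> depending on \<open>a\<close>, so the commutator of \<open>f a w\<close> and
  \<open>f b v\<close> is antisymmetric in \<open>a\<close> and \<open>b\<close>. Sums over ordered pairs of distinct factors of
  antisymmetric coefficients times \<open>T (A - {a, b})\<close> vanish, whence by induction the derivative of
  \<open>T A\<close> in direction \<open>v\<close> is \<open>card A \<cdot> (\<Sum>a\<in>A. f a v \<cdot> T (A - {a}))\<close>, with \<open>f a v\<close> on either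
  side. Regularity reduces to that of the single factors, and the Laplacian to another
  antisymmetric sum because \<open>e\<^sub>2, e\<^sub>3, e\<^sub>4\<close> anticommute and their squares cancel against the
  signs of the Laplacian.\<close>

section \<open>Ordered products and the symmetrized product\<close>

lemma bounded_bilinear_hmult: "bounded_bilinear (hmult t)"
  using bilinear_conv_bounded_bilinear bilinear_hmult by blast

interpretation hmult: bounded_bilinear "hmult t" for t
  by (rule bounded_bilinear_hmult)

text \<open>Labels are ordered rather than their values, so equal factors count with multiplicity
  and deleting one factor is a set difference. Without normalisation the recursion has no
  coefficients.\<close>

definition ord_sum :: "real \<Rightarrow> ('a \<Rightarrow> hyp) \<Rightarrow> 'a set \<Rightarrow> hyp" where
  "ord_sum t g A = (\<Sum>xs\<in>permutations_of_set A. hprod_list t (map g xs))"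

lemma ord_sum_empty [simp]: "ord_sum t g {} = h1"
  by (simp add: ord_sum_def hprod_list_def)

text \<open>Orderings are grouped by their first entry \<open>a\<close>; the remaining entries are
  an ordering of \<open>A - {a}\<close>.\<close>

lemma ord_sum_rec:
  assumes "finite A" "A \<noteq> {}"
  shows "ord_sum t g A = (\<Sum>a\<in>A. hmult t (g a) (ord_sum t g (A - {a})))"
proof -
  have "ord_sum t g A
      = (\<Sum>a\<in>A. \<Sum>xs\<in>(#) a ` permutations_of_set (A - {a}). hprod_list t (map g xs))"
    unfolding ord_sum_def permutations_of_set_nonempty[OF assms(2)]
    by (rule sum.UNION_disjoint) (use assms in auto)
  also have "\<dots> = (\<Sum>a\<in>A. hmult t (g a) (ord_sum t g (A - {a})))"
    by (simp add: ord_sum_def hmult.sum_right sum.reindex hprod_list_def)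
  finally show ?thesis .
qed

text \<open>Listing the values of \<open>\<sigma>\<close> is injective because permutations agree
  outside \<open>{..<n}\<close>; it is onto because both sides have \<open>fact n\<close>
  elements.\<close>

lemma sum_permutes_eq_sum_permutations_of_set:
  "(\<Sum>\<sigma> | \<sigma> permutes {..<n}. F (map \<sigma> [0..<n])) = (\<Sum>xs\<in>permutations_of_set {..<n}. F xs)"
proof -
  have inj: "inj_on (\<lambda>\<sigma>. map \<sigma> [0..<n]) {\<sigma>. \<sigma> permutes {..<n}}"
  proof (rule inj_onI, rule ext)
    fix \<sigma> \<tau> :: "nat \<Rightarrow> nat" and x
    assume "\<sigma> \<in> {\<sigma>. \<sigma> permutes {..<n}}" "\<tau> \<in> {\<sigma>. \<sigma> permutes {..<n}}"
      "map \<sigma> [0..<n] = map \<tau> [0..<n]"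
    then show "\<sigma> x = \<tau> x"
      by (cases "x < n") (auto simp: permutes_not_in)
  qed
  have sub: "(\<lambda>\<sigma>. map \<sigma> [0..<n]) ` {\<sigma>. \<sigma> permutes {..<n}} \<subseteq> permutations_of_set {..<n}"
    by (auto simp: permutations_of_set_def distinct_map atLeast0LessThan permutes_in_image
          permutes_image intro: permutes_inj_on)
  have "card ((\<lambda>\<sigma>. map \<sigma> [0..<n]) ` {\<sigma>. \<sigma> permutes {..<n}}) = card (permutations_of_set {..<n})"
    using card_permutations[of "{..<n}" n] by (simp add: card_image[OF inj])
  then have "(\<lambda>\<sigma>. map \<sigma> [0..<n]) ` {\<sigma>. \<sigma> permutes {..<n}} = permutations_of_set {..<n}"
    by (intro card_subset_eq sub) auto
  then show ?thesis
    using sum.reindex[OF inj, of F] by (simp add: o_def)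
qed

lemma sym_prod_eq_ord_sum:
  "sym_prod t fs w = (1 / fact (length fs)) *\<^sub>R ord_sum t (\<lambda>m. (fs ! m) w) {..<length fs}"
  unfolding sym_prod_def ord_sum_def
  using sum_permutes_eq_sum_permutations_of_set[of "\<lambda>xs. hprod_list t (map (\<lambda>m. (fs ! m) w) xs)"]
  by (simp add: o_def)

section \<open>Antisymmetric sums over pairs of distinct factors\<close>

lemma sum_Diff_swap:
  fixes h :: "'a \<Rightarrow> 'a \<Rightarrow> 'b::comm_monoid_add"
  assumes "finite A"
  shows "(\<Sum>a\<in>A. \<Sum>b\<in>A - {a}. h a b) = (\<Sum>a\<in>A. \<Sum>b\<in>A - {a}. h b a)"
proof -
  have "(\<Sum>a\<in>A. \<Sum>b\<in>A - {a}. h a b) = (\<Sum>a\<in>A. \<Sum>b | b \<in> A \<and> a \<noteq> b. h a b)"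
    by (intro sum.cong refl) auto
  also have "\<dots> = (\<Sum>b\<in>A. \<Sum>a | a \<in> A \<and> a \<noteq> b. h a b)"
    by (rule sum.swap_restrict) (use assms in auto)
  also have "\<dots> = (\<Sum>a\<in>A. \<Sum>b\<in>A - {a}. h b a)"
    by (intro sum.cong refl) auto
  finally show ?thesis .
qed

lemma Diff_singleton_commute: "A - {a} - {b} = A - {b} - {a}"
  by blast

text \<open>Exchanging \<open>a\<close> and \<open>b\<close> flips the sign of the coefficient but
  leaves the argument of \<open>F\<close> unchanged, so the sum equals its own negative.\<close>

lemma sum_Diff_antisym:
  assumes "finite A" "\<And>a b. a \<in> A \<Longrightarrow> b \<in> A \<Longrightarrow> B a b = - B b a"
  shows "(\<Sum>a\<in>A. \<Sum>b\<in>A - {a}. hmult t (B a b) (F (A - {a} - {b}))) = 0"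
    (is "?S = 0")
proof -
  have "?S = (\<Sum>a\<in>A. \<Sum>b\<in>A - {a}. hmult t (B b a) (F (A - {b} - {a})))"
    by (rule sum_Diff_swap) fact
  also have "\<dots> = (\<Sum>a\<in>A. \<Sum>b\<in>A - {a}. - hmult t (B a b) (F (A - {a} - {b})))"
  proof (intro sum.cong refl)
    fix a b assume "a \<in> A" "b \<in> A - {a}"
    then show "hmult t (B b a) (F (A - {b} - {a})) = - hmult t (B a b) (F (A - {a} - {b}))"
      using assms(2)[of b a] by (simp add: hmult.minus_left Diff_singleton_commute[of A b a])
  qed
  also have "\<dots> = - ?S"
    by (simp add: sum_negf)
  finally have "?S + ?S = 0" by simp
  then show ?thesis using scaleR_half_double[of ?S] by simp
qed

section \<open>The three generating functions\<close>

definition eta_gens :: "real \<Rightarrow> (hyp \<Rightarrow> hyp) set" where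
  "eta_gens t = {eta2, eta3 t, eta4 t}"

lemma eta_gens_linear:
  assumes "f \<in> eta_gens t"
  shows "bounded_linear f"
proof -
  have "linear f"
    using assms by (auto simp: eta_gens_def linear_iff eta2_def eta3_def eta4_def hyp_eq_iff
        algebra_simps add_divide_distrib)
  then show ?thesis by (rule linear_conv_bounded_linear[THEN iffD1])
qed

text \<open>Each generator is a real coordinate plus \<open>w$1\<close> times a constant. Real parts
  commute, so the commutator is \<open>w$1 * v$1\<close> times that of the two constants, which is
  antisymmetric.\<close>

lemma eta_gens_commutator_antisym:
  assumes "f \<in> eta_gens t" "g \<in> eta_gens t"
  shows "hmult t (f w) (g v) - hmult t (g v) (f w) = - (hmult t (g w) (f v) - hmult t (f v) (g w))"
  using assms
  by (auto simp: eta_gens_def eta2_def eta3_def eta4_def hyp_eq_iff hmult_def algebra_simps)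

text \<open>For \<open>f \<noteq> g\<close> only the first term survives, and the two constants
  \<open>f (axis 1 1)\<close> and \<open>g (axis 1 1)\<close> anticommute. For \<open>f = g\<close>
  the square of the constant cancels the one other nonzero term, so
  \<open>B f f = 0\<close>.\<close>

lemma eta_gens_laplace_antisym:
  assumes "t \<noteq> 0" "f \<in> eta_gens t" "g \<in> eta_gens t"
  defines "B \<equiv> (\<lambda>f g. hmult t (f (axis 1 1)) (g (axis 1 1)) + hmult t (f (axis 2 1)) (g (axis 2 1))
     - sgn t *\<^sub>R hmult t (f (axis 3 1)) (g (axis 3 1))
     - sgn t *\<^sub>R hmult t (f (axis 4 1)) (g (axis 4 1)))"
  shows "B f g = - B g f"
proof -
  \<comment> \<open>This is the square of the constant in \<open>eta3\<close> and
    \<open>eta4\<close>, namely \<open>t / \<bar>t\<bar>\<close>.\<close>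
  have "t * (sgn t * sgn t / (sqrt \<bar>t\<bar> * sqrt \<bar>t\<bar>)) = sgn t"
    using assms(1) by (auto simp: sgn_if)
  then show ?thesis
    using assms(2,3) unfolding B_def
    by (auto simp: eta_gens_def eta2_def eta3_def eta4_def hyp_eq_iff hmult_def axis_def)
qed

text \<open>Only one derivative besides the first is nonzero; it equals \<open>h1\<close>, and its
  coefficient in the operator is minus \<open>f (axis 1 1)\<close>.\<close>

lemma eta_gens_nabla:
  assumes "f \<in> eta_gens t"
  shows "f (axis 1 1) + hmult t hi (f (axis 2 1))
     - (sgn t / sqrt \<bar>t\<bar>) *\<^sub>R hmult t hj (f (axis 3 1))
     - (sgn t / sqrt \<bar>t\<bar>) *\<^sub>R hmult t hk (f (axis 4 1)) = 0"
    and "f (axis 1 1) + hmult t (f (axis 2 1)) hi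
     - (sgn t / sqrt \<bar>t\<bar>) *\<^sub>R hmult t (f (axis 3 1)) hj
     - (sgn t / sqrt \<bar>t\<bar>) *\<^sub>R hmult t (f (axis 4 1)) hk = 0"
  using assms
  by (auto simp: eta_gens_def eta2_def eta3_def eta4_def hyp_eq_iff hmult_def axis_def)

section \<open>Commutation and derivatives of ordered sums\<close>

lemma ord_sum_commute:
  assumes "finite A" "\<And>a. a \<in> A \<Longrightarrow> f a \<in> eta_gens t"
  shows "(\<Sum>a\<in>A. hmult t (f a v) (ord_sum t (\<lambda>a. f a w) (A - {a})))
       = (\<Sum>a\<in>A. hmult t (ord_sum t (\<lambda>a. f a w) (A - {a})) (f a v))"
  using assms
proof (induction A rule: finite_psubset_induct)
  case (psubset A)
  define T where "T = ord_sum t (\<lambda>a. f a w)"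
  show ?case
  \<comment> \<open>The recursion for \<open>A - {a}\<close> needs a nonempty set.\<close>
  proof (cases "\<exists>a. A \<subseteq> {a}")
    case True
    then obtain a where "A \<subseteq> {a}" by blast
    then show ?thesis by (auto simp: subset_singleton_iff)
  next
    case False
    have rec: "T (A - {a}) = (\<Sum>b\<in>A - {a}. hmult t (f b w) (T (A - {a} - {b})))" for a
      unfolding T_def using False psubset.hyps by (intro ord_sum_rec) auto
    \<comment> \<open>Moving \<open>f a v\<close> past the first factor \<open>f b w\<close> leaves
      a commutator, whose sum vanishes, and a remainder handled by induction on
      \<open>A - {b}\<close>.\<close>
    have "(\<Sum>a\<in>A. hmult t (f a v) (T (A - {a}))) - (\<Sum>a\<in>A. hmult t (T (A - {a})) (f a v))
       = (\<Sum>a\<in>A. \<Sum>b\<in>A - {a}.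
            hmult t (hmult t (f a v) (f b w) - hmult t (f b w) (f a v)) (T (A - {a} - {b})))
       + (\<Sum>a\<in>A. \<Sum>b\<in>A - {a}. hmult t (f b w)
            (hmult t (f a v) (T (A - {a} - {b})) - hmult t (T (A - {a} - {b})) (f a v)))"
      unfolding rec
      by (simp add: hmult.sum_left hmult.sum_right hmult.diff_left hmult.diff_right hmult_assoc
          flip: sum.distrib sum_subtractf)
    also have "(\<Sum>a\<in>A. \<Sum>b\<in>A - {a}.
            hmult t (hmult t (f a v) (f b w) - hmult t (f b w) (f a v)) (T (A - {a} - {b}))) = 0"
      by (intro sum_Diff_antisym eta_gens_commutator_antisym psubset.hyps psubset.prems)
    also have "(\<Sum>a\<in>A. \<Sum>b\<in>A - {a}. hmult t (f b w)
            (hmult t (f a v) (T (A - {a} - {b})) - hmult t (T (A - {a} - {b})) (f a v)))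
       = (\<Sum>b\<in>A. \<Sum>a\<in>A - {b}. hmult t (f b w)
            (hmult t (f a v) (T (A - {a} - {b})) - hmult t (T (A - {a} - {b})) (f a v)))"
      by (rule sum_Diff_swap) fact
    also have "\<dots> = (\<Sum>b\<in>A. hmult t (f b w)
            ((\<Sum>a\<in>A - {b}. hmult t (f a v) (T (A - {b} - {a})))
           - (\<Sum>a\<in>A - {b}. hmult t (T (A - {b} - {a})) (f a v))))"
      by (simp only: hmult.sum_right hmult.diff_right sum_subtractf Diff_singleton_commute)
    also have "\<dots> = 0"
    proof (rule sum.neutral, rule ballI)
      fix b assume "b \<in> A"
      then have "(\<Sum>a\<in>A - {b}. hmult t (f a v) (T (A - {b} - {a})))
           = (\<Sum>a\<in>A - {b}. hmult t (T (A - {b} - {a})) (f a v))"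
        unfolding T_def by (intro psubset.IH) (use psubset.prems in auto)
      then show "hmult t (f b w)
            ((\<Sum>a\<in>A - {b}. hmult t (f a v) (T (A - {b} - {a})))
           - (\<Sum>a\<in>A - {b}. hmult t (T (A - {b} - {a})) (f a v))) = 0"
        by (simp add: hmult.zero_right)
    qed
    finally show ?thesis by (simp add: T_def)
  qed
qed

text \<open>The product rule places \<open>f a v\<close> at each of the \<open>card A\<close>
  positions; since commutators cancel in the sum it can be moved to the front, so all positions
  contribute equally.\<close>

lemma ord_sum_has_derivative:
  assumes "finite A" "\<And>a. a \<in> A \<Longrightarrow> f a \<in> eta_gens t"
  shows "((\<lambda>w. ord_sum t (\<lambda>a. f a w) A) has_derivative
     (\<lambda>v. real (card A) *\<^sub>R (\<Sum>a\<in>A. hmult t (f a v) (ord_sum t (\<lambda>a. f a w) (A - {a}))))) (at w)"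
  using assms
proof (induction A rule: finite_psubset_induct)
  case (psubset A)
  define T where "T = (\<lambda>w. ord_sum t (\<lambda>a. f a w))"
  show ?case
  proof (cases "A = {}")
    case True
    then show ?thesis by simp
  next
    case False
    let ?n = "real (card A - 1)"
    have n: "real (card A) = 1 + ?n"
      using False psubset.hyps by (simp add: Suc_leI card_gt_0_iff)
    have rec: "T w A = (\<Sum>a\<in>A. hmult t (f a w) (T w (A - {a})))" for w
      unfolding T_def by (rule ord_sum_rec) (use False psubset.hyps in auto)
    have D: "((\<lambda>w. T w A) has_derivative (\<lambda>v. \<Sum>a\<in>A.
        hmult t (f a w) (?n *\<^sub>R (\<Sum>b\<in>A - {a}. hmult t (f b v) (T w (A - {a} - {b}))))
        + hmult t (f a v) (T w (A - {a})))) (at w)"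
      unfolding rec
    proof (rule has_derivative_sum)
      fix a assume a: "a \<in> A"
      have "((\<lambda>w. T w (A - {a})) has_derivative
         (\<lambda>v. ?n *\<^sub>R (\<Sum>b\<in>A - {a}. hmult t (f b v) (T w (A - {a} - {b}))))) (at w)"
        using psubset.IH[of "A - {a}"] psubset.prems a by (auto simp: T_def card_Diff_singleton)
      moreover have "(f a has_derivative f a) (at w)"
        by (rule bounded_linear_imp_has_derivative[OF eta_gens_linear[OF psubset.prems[OF a]]])
      ultimately show "((\<lambda>w. hmult t (f a w) (T w (A - {a}))) has_derivative
         (\<lambda>v. hmult t (f a w) (?n *\<^sub>R (\<Sum>b\<in>A - {a}. hmult t (f b v) (T w (A - {a} - {b}))))
           + hmult t (f a v) (T w (A - {a})))) (at w)"
        by (rule hmult.FDERIV[rotated])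
    qed
    have "(\<Sum>a\<in>A. hmult t (f a w) (?n *\<^sub>R (\<Sum>b\<in>A - {a}. hmult t (f b v) (T w (A - {a} - {b}))))
        + hmult t (f a v) (T w (A - {a})))
      = real (card A) *\<^sub>R (\<Sum>a\<in>A. hmult t (f a v) (T w (A - {a})))" for v
    proof -
      have "(\<Sum>a\<in>A. \<Sum>b\<in>A - {a}. hmult t (hmult t (f a w) (f b v)) (T w (A - {a} - {b})))
         - (\<Sum>a\<in>A. \<Sum>b\<in>A - {a}. hmult t (hmult t (f b v) (f a w)) (T w (A - {a} - {b})))
         = (\<Sum>a\<in>A. \<Sum>b\<in>A - {a}.
             hmult t (hmult t (f a w) (f b v) - hmult t (f b v) (f a w)) (T w (A - {a} - {b})))"
        by (simp add: hmult.diff_left sum_subtractf)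
      also have "\<dots> = 0"
        by (intro sum_Diff_antisym eta_gens_commutator_antisym psubset.hyps psubset.prems)
      finally have "(\<Sum>a\<in>A. \<Sum>b\<in>A - {a}. hmult t (hmult t (f a w) (f b v)) (T w (A - {a} - {b})))
         = (\<Sum>a\<in>A. \<Sum>b\<in>A - {a}. hmult t (hmult t (f b v) (f a w)) (T w (A - {a} - {b})))"
        by simp
      \<comment> \<open>With the names exchanged, the differentiated factor is outermost and the
        inner sum is the recursion for \<open>T w (A - {a})\<close>.\<close>
      also have "\<dots> = (\<Sum>a\<in>A. \<Sum>b\<in>A - {a}. hmult t (hmult t (f a v) (f b w)) (T w (A - {b} - {a})))"
        by (rule sum_Diff_swap) fact
      also have "\<dots> = (\<Sum>a\<in>A. hmult t (f a v) (\<Sum>b\<in>A - {a}. hmult t (f b w) (T w (A - {a} - {b}))))"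
        by (simp only: hmult.sum_right hmult_assoc Diff_singleton_commute)
      finally have "?n *\<^sub>R (\<Sum>a\<in>A. \<Sum>b\<in>A - {a}. hmult t (hmult t (f a w) (f b v)) (T w (A - {a} - {b})))
         = (\<Sum>a\<in>A. hmult t (f a v) (?n *\<^sub>R (\<Sum>b\<in>A - {a}. hmult t (f b w) (T w (A - {a} - {b})))))"
        by (simp only: hmult.scaleR_right flip: scaleR_sum_right)
      also have "\<dots> = (\<Sum>a\<in>A. hmult t (f a v) (?n *\<^sub>R T w (A - {a})))"
      proof (intro sum.cong refl)
        fix a assume a: "a \<in> A"
        show "hmult t (f a v) (?n *\<^sub>R (\<Sum>b\<in>A - {a}. hmult t (f b w) (T w (A - {a} - {b}))))
            = hmult t (f a v) (?n *\<^sub>R T w (A - {a}))"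
        \<comment> \<open>For a singleton \<open>A\<close> the recursion fails, as
          \<open>T w {} = h1\<close> while the sum is empty, but then the factor \<open>?n\<close>
          is zero.\<close>
        proof (cases "A - {a} = {}")
          case True
          then have "?n = 0" using a by (metis card_Diff_singleton card.empty of_nat_0)
          then show ?thesis by simp
        next
          case False
          then show ?thesis
            unfolding T_def using psubset.hyps by (subst ord_sum_rec[of "A - {a}"]) auto
        qed
      qed
      finally show ?thesis
        by (simp add: n sum.distrib scaleR_add_left hmult.scaleR_right hmult.sum_right hmult_assoc
            flip: scaleR_sum_right)
    qed
    with D show ?thesis by (simp add: T_def)
  qed
qed

section \<open>Partial derivatives, regularity and harmonicity\<close>

lemma partial_deriv_eq:
  assumes "(f has_derivative f') (at w)"
  shows "partial_deriv m f w = f' (axis m 1)"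
proof -
  have "((\<lambda>s. f (w + s *\<^sub>R axis m 1)) has_derivative (\<lambda>s. f' (s *\<^sub>R axis m 1))) (at 0)"
    by (rule has_derivative_compose[of "\<lambda>s. w + s *\<^sub>R axis m 1" "\<lambda>s. s *\<^sub>R axis m 1" 0 UNIV f f'])
      (use assms in \<open>auto intro!: derivative_eq_intros\<close>)
  moreover have "f' (s *\<^sub>R axis m 1) = s *\<^sub>R f' (axis m 1)" for s
    using assms by (simp add: has_derivative_def linear_simps)
  ultimately show ?thesis
    unfolding partial_deriv_def by (intro vector_derivative_at) (simp add: has_vector_derivative_def)
qed

theorem theorem45:
  fixes t :: real and n :: "nat \<times> nat \<times> nat"
  assumes "t \<noteq> 0"
  shows "t_harmonic t (eta t n) \<and> t_regular t (eta t n)"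
proof -
  obtain n1 n2 n3 where n: "n = (n1, n2, n3)" by (cases n)
  define fs where "fs = replicate n1 eta2 @ replicate n2 (eta3 t) @ replicate n3 (eta4 t)"
  define f where "f = (\<lambda>m. fs ! m)"
  define A where "A = {..<length fs}"
  define T where "T = (\<lambda>B w. ord_sum t (\<lambda>a. f a w) B)"
  define c :: real where "c = 1 / (fact n1 * fact n2 * fact n3) * (1 / fact (length fs))"
  have finA: "finite A" by (simp add: A_def)
  have gens: "f a \<in> eta_gens t" if "a \<in> A" for a
    using nth_mem[of a fs] that by (auto simp: A_def f_def fs_def eta_gens_def)
  have eta: "eta t n = (\<lambda>w. c *\<^sub>R T A w)"
    by (simp add: fun_eq_iff eta_def n sym_prod_eq_ord_sum c_def T_def A_def f_def fs_def)
  have DT: "(T B has_derivative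
      (\<lambda>v. real (card B) *\<^sub>R (\<Sum>a\<in>B. hmult t (f a v) (T (B - {a}) w)))) (at w)"
    if "B \<subseteq> A" for B w
    unfolding T_def using that finA by (intro ord_sum_has_derivative) (auto intro: finite_subset gens)
  define k where "k = c * real (card A)"
  have D1: "(eta t n has_derivative (\<lambda>v. k *\<^sub>R (\<Sum>a\<in>A. hmult t (f a v) (T (A - {a}) w)))) (at w)" for w
    unfolding eta using has_derivative_scaleR_right[OF DT[OF order.refl, of w], of c] by (simp add: k_def)
  have P1: "partial_deriv m (eta t n)
      = (\<lambda>w. k *\<^sub>R (\<Sum>a\<in>A. hmult t (f a (axis m 1)) (T (A - {a}) w)))" for m
    using partial_deriv_eq[OF D1] by (simp add: fun_eq_iff)
  \<comment> \<open>The right operator multiplies by units on the right, so the differentiated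
    factor must stand last.\<close>
  have P1': "partial_deriv m (eta t n)
      = (\<lambda>w. k *\<^sub>R (\<Sum>a\<in>A. hmult t (T (A - {a}) w) (f a (axis m 1))))" for m
    unfolding P1 T_def using ord_sum_commute[OF finA gens] by simp
  \<comment> \<open>For \<open>a \<in> A\<close> the second factor is the cardinality of
    \<open>A - {a}\<close>, which the second differentiation brings out.\<close>
  define l where "l = k * real (card A - 1)"
  have D2: "(partial_deriv m (eta t n) has_derivative (\<lambda>v. l *\<^sub>R (\<Sum>a\<in>A. \<Sum>b\<in>A - {a}.
      hmult t (hmult t (f a (axis m 1)) (f b v)) (T (A - {a} - {b}) w)))) (at w)" for m w
  proof -
    have "(T (A - {a}) has_derivative (\<lambda>v. real (card A - 1) *\<^sub>R
        (\<Sum>b\<in>A - {a}. hmult t (f b v) (T (A - {a} - {b}) w)))) (at w)" if "a \<in> A" for a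
      using DT[of "A - {a}" w] that by (simp add: card_Diff_singleton)
    then have "((\<lambda>w. k *\<^sub>R (\<Sum>a\<in>A. hmult t (f a (axis m 1)) (T (A - {a}) w))) has_derivative
       (\<lambda>v. k *\<^sub>R (\<Sum>a\<in>A. hmult t (f a (axis m 1)) (real (card A - 1) *\<^sub>R
        (\<Sum>b\<in>A - {a}. hmult t (f b v) (T (A - {a} - {b}) w)))))) (at w)"
      by (intro has_derivative_scaleR_right has_derivative_sum
          bounded_linear.has_derivative[OF hmult.bounded_linear_right])
    then show ?thesis
      by (simp add: P1 l_def hmult.scaleR_right hmult.sum_right hmult_assoc flip: scaleR_sum_right)
  qed
  have P2: "partial_deriv m (partial_deriv m (eta t n)) w = l *\<^sub>R (\<Sum>a\<in>A. \<Sum>b\<in>A - {a}.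
      hmult t (hmult t (f a (axis m 1)) (f b (axis m 1))) (T (A - {a} - {b}) w))" for m w
    by (rule partial_deriv_eq[OF D2])
  have "laplace t (eta t n) w = 0" for w
  proof -
    define B where "B = (\<lambda>a b. hmult t (f a (axis 1 1)) (f b (axis 1 1))
       + hmult t (f a (axis 2 1)) (f b (axis 2 1))
       - sgn t *\<^sub>R hmult t (f a (axis 3 1)) (f b (axis 3 1))
       - sgn t *\<^sub>R hmult t (f a (axis 4 1)) (f b (axis 4 1)))"
    have "laplace t (eta t n) w
        = l *\<^sub>R (\<Sum>a\<in>A. \<Sum>b\<in>A - {a}. hmult t (B a b) (T (A - {a} - {b}) w))"
      by (simp add: laplace_def P2 B_def hmult.add_left hmult.diff_left hmult.scaleR_left
          sum.distrib sum_subtractf scaleR_add_right scaleR_diff_right mult.commute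
          flip: scaleR_sum_right)
    also have "(\<Sum>a\<in>A. \<Sum>b\<in>A - {a}. hmult t (B a b) (T (A - {a} - {b}) w)) = 0"
      by (rule sum_Diff_antisym[OF finA, where F = "\<lambda>C. T C w"])
        (unfold B_def, intro eta_gens_laplace_antisym assms gens)
    finally show ?thesis by simp
  qed
  moreover have "nabla_left t (eta t n) w = 0" for w
  proof -
    let ?s = "sgn t / sqrt \<bar>t\<bar>"
    \<comment> \<open>By associativity the operator acts only on the leading factor
      \<open>f a\<close>, which it annihilates.\<close>
    have "nabla_left t (eta t n) w = k *\<^sub>R (\<Sum>a\<in>A. hmult t
       (f a (axis 1 1) + hmult t hi (f a (axis 2 1))
        - ?s *\<^sub>R hmult t hj (f a (axis 3 1)) - ?s *\<^sub>R hmult t hk (f a (axis 4 1))) (T (A - {a}) w))"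
      by (simp add: nabla_left_def P1 hmult.add_left hmult.diff_left hmult.scaleR_left hmult.scaleR_right
          hmult.sum_right hmult_assoc sum.distrib sum_subtractf scaleR_add_right scaleR_diff_right
          mult.commute flip: scaleR_sum_right)
    then show ?thesis by (simp add: eta_gens_nabla gens hmult.zero_left)
  qed
  moreover have "nabla_right t (eta t n) w = 0" for w
  proof -
    let ?s = "sgn t / sqrt \<bar>t\<bar>"
    have "nabla_right t (eta t n) w = k *\<^sub>R (\<Sum>a\<in>A. hmult t (T (A - {a}) w)
       (f a (axis 1 1) + hmult t (f a (axis 2 1)) hi
        - ?s *\<^sub>R hmult t (f a (axis 3 1)) hj - ?s *\<^sub>R hmult t (f a (axis 4 1)) hk))"
      by (simp add: nabla_right_def P1' hmult.add_right hmult.diff_right hmult.scaleR_left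
          hmult.scaleR_right hmult.sum_left hmult_assoc sum.distrib sum_subtractf scaleR_add_right
          scaleR_diff_right mult.commute flip: scaleR_sum_right)
    then show ?thesis by (simp add: eta_gens_nabla gens hmult.zero_right)
  qed
  moreover have "eta t n differentiable (at w)" "partial_deriv m (eta t n) differentiable (at w)" for m w
    using D1 D2 unfolding differentiable_def by blast+
  ultimately show ?thesis
    unfolding t_harmonic_def t_regular_def by blast
qed

end
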